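(* Let $X$ be a set with $|X|\geq2$, and let $E=E(\mathcal{I}_X)=\{\mathrm{id}_A:A\subseteq X\}\subseteq\mathcal{P}_X$ be the semilattice of idempotents of the symmetric inverse monoid $\mathcal{I}_X$. Then $\mathscr{R}^E$ is not a left congruence on the partition monoid $\mathcal{P}_X$, and $\mathscr{L}^E$ is not a right congruence on $\mathcal{P}_X$. Consequently $\mathcal{P}_X$ is not $E$-Ehresmann.
   Context: Partition monoid: let $X$ be a set and $X'=\{x':x\in X\}$ a disjoint copy of $X$. $\mathcal{P}_X$ is the set of all set partitions of $X\cup X'$. Given $\alpha,\beta\in\mathcal{P}_X$, let $X''=\{x'':x\in X\}$ be another disjoint copy; represent $\alpha$ and $\beta$ by graphs on $X\cup X'$ whose connected components are the blocks; rename each lower vertex $x'$ of $\alpha$ to $x''$ and each upper vertex $x$ of $\beta$ to $x''$; take the union of these graphs on $X\cup X''\cup X'$. The product $\alpha\beta$ is the partition of $X\cup X'$ in which two elements lie in the same block iff they are joined by a path in this union graph. This makes $\mathcal{P}_X$ a monoid. $\ker(\alpha)$ (resp. $\mathrm{coker}(\alpha)$) is the equivalence on $X$ of all $(x,y)$ with $x,y$ (resp. $x',y'$) in the same block of $\alpha$; $\Delta$ is the equality relation on $X$. The symmetric inverse monoid is (identified with) the submonoid $\mathcal{I}_X=\{\alpha\in\mathcal{P}_X:\ker(\alpha)=\mathrm{coker}(\alpha)=\Delta\}$. For $A\subseteq X$, $\mathrm{id}_A=\{\{a,a'\}:a\in A\}\cup\{\{x\},\{x'\}:x\in X\setminus A\}$;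 the idempotents of $\mathcal{I}_X$ are exactly the $\mathrm{id}_A$, and $\mathrm{id}_A\mathrm{id}_B=\mathrm{id}_{A\cap B}$. Ehresmann semigroups: let $S$ be a semigroup and $E\subseteq S$ a semilattice (a commutative subsemigroup consisting of idempotents). For $x\in S$ let $E_L(x)=\{e\in E:x=ex\}$ and $E_R(x)=\{e\in E:x=xe\}$. Define $x\,\mathscr{R}^E\,y\iff E_L(x)=E_L(y)$ and $x\,\mathscr{L}^E\,y\iff E_R(x)=E_R(y)$. $S$ is left $E$-Ehresmann if every $\mathscr{R}^E$-class contains precisely one element of $E$ and $\mathscr{R}^E$ is a left congruence ($x\,\mathscr{R}^E\,y\Rightarrow ax\,\mathscr{R}^E\,ay$). $S$ is right $E$-Ehresmann if every $\mathscr{L}^E$-class contains precisely one element of $E$ and $\mathscr{L}^E$ is a right congruence ($x\,\mathscr{L}^E\,y\Rightarrow xa\,\mathscr{L}^E\,ya$). $S$ is $E$-Ehresmann if it is both left and right $E$-Ehresmann. *)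

theory Defs
  imports "HOL-Algebra.Group" "HOL-Library.Disjoint_Sets"
begin

section \<open>The partition monoid\<close>

text \<open>
  The disjoint union of \<open>X\<close> and its copy \<open>X'\<close> is \<open>X <+> X\<close>: the upper vertex \<open>x\<close> is \<open>Inl x\<close>
  and the lower vertex \<open>x'\<close> is \<open>Inr x\<close>.
\<close>

definition same_block :: "('a + 'a) set set \<Rightarrow> (('a + 'a) \<times> ('a + 'a)) set" where
  "same_block \<alpha> = {(u, v). \<exists>B\<in>\<alpha>. u \<in> B \<and> v \<in> B}"

text \<open>Vertices \<open>x\<close>, \<open>x''\<close> and \<open>x'\<close> of the product graph, in this order.\<close>

datatype 'a vertex = Upper 'a | Middle 'a | Lower 'a

definition rename_lower :: "'a + 'a \<Rightarrow> 'a vertex" where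
  "rename_lower = case_sum Upper Middle"

definition rename_upper :: "'a + 'a \<Rightarrow> 'a vertex" where
  "rename_upper = case_sum Middle Lower"

definition outer_vertex :: "'a + 'a \<Rightarrow> 'a vertex" where
  "outer_vertex = case_sum Upper Lower"

text \<open>
  A partition is represented by the graph in which any two vertices of a block are adjacent
  (loops included). Its edge relation is symmetric, so paths in the union graph are given by
  the reflexive transitive closure.
\<close>

definition product_graph ::
    "('a + 'a) set set \<Rightarrow> ('a + 'a) set set \<Rightarrow> ('a vertex \<times> 'a vertex) set" where
  "product_graph \<alpha> \<beta> =
     map_prod rename_lower rename_lower ` same_block \<alpha> \<union>
     map_prod rename_upper rename_upper ` same_block \<beta>"

definition partition_mult ::
    "'a set \<Rightarrow> ('a + 'a) set set \<Rightarrow> ('a + 'a) set set \<Rightarrow> ('a + 'a) set set" where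
  "partition_mult X \<alpha> \<beta> =
     (X <+> X) // {(u, v). u \<in> X <+> X \<and> v \<in> X <+> X \<and>
                    (outer_vertex u, outer_vertex v) \<in> (product_graph \<alpha> \<beta>)\<^sup>*}"

definition id_part :: "'a set \<Rightarrow> 'a set \<Rightarrow> ('a + 'a) set set" where
  "id_part X A =
     {{Inl a, Inr a} | a. a \<in> A} \<union> {{Inl x} | x. x \<in> X - A} \<union> {{Inr x} | x. x \<in> X - A}"

definition partition_monoid :: "'a set \<Rightarrow> ('a + 'a) set set monoid" where
  "partition_monoid X =
     \<lparr>carrier = {\<alpha>. partition_on (X <+> X) \<alpha>}, mult = partition_mult X, one = id_part X X\<rparr>"


section \<open>The symmetric inverse monoid\<close>

definition part_ker :: "('a + 'a) set set \<Rightarrow> ('a \<times> 'a) set" where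
  "part_ker \<alpha> = {(x, y). (Inl x, Inl y) \<in> same_block \<alpha>}"

definition part_coker :: "('a + 'a) set set \<Rightarrow> ('a \<times> 'a) set" where
  "part_coker \<alpha> = {(x, y). (Inr x, Inr y) \<in> same_block \<alpha>}"

definition sym_inv_monoid :: "'a set \<Rightarrow> ('a + 'a) set set monoid" where
  "sym_inv_monoid X = (partition_monoid X)
     \<lparr>carrier := {\<alpha> \<in> carrier (partition_monoid X).
                    part_ker \<alpha> = Id_on X \<and> part_coker \<alpha> = Id_on X}\<rparr>"

definition idempotents :: "('a, 'b) monoid_scheme \<Rightarrow> 'a set" where
  "idempotents S = {e \<in> carrier S. e \<otimes>\<^bsub>S\<^esub> e = e}"


section \<open>Ehresmann semigroups\<close>

text \<open>
  The standing assumptions that \<open>S\<close> is a semigroup and \<open>E\<close> a semilattice in it are not part of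
  the predicates below, so that failing to be Ehresmann is a failure of the Ehresmann
  conditions themselves. The unit of the monoid record plays no role.
\<close>

definition semilattice_in :: "('a, 'b) monoid_scheme \<Rightarrow> 'a set \<Rightarrow> bool" where
  "semilattice_in S E \<longleftrightarrow> E \<subseteq> carrier S \<and>
     (\<forall>e\<in>E. \<forall>f\<in>E. e \<otimes>\<^bsub>S\<^esub> f \<in> E \<and> e \<otimes>\<^bsub>S\<^esub> f = f \<otimes>\<^bsub>S\<^esub> e) \<and>
     (\<forall>e\<in>E. e \<otimes>\<^bsub>S\<^esub> e = e)"

definition left_ids :: "('a, 'b) monoid_scheme \<Rightarrow> 'a set \<Rightarrow> 'a \<Rightarrow> 'a set" where
  "left_ids S E x = {e \<in> E. x = e \<otimes>\<^bsub>S\<^esub> x}"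

definition right_ids :: "('a, 'b) monoid_scheme \<Rightarrow> 'a set \<Rightarrow> 'a \<Rightarrow> 'a set" where
  "right_ids S E x = {e \<in> E. x = x \<otimes>\<^bsub>S\<^esub> e}"

definition R_rel :: "('a, 'b) monoid_scheme \<Rightarrow> 'a set \<Rightarrow> ('a \<times> 'a) set" where
  "R_rel S E = {(x, y). x \<in> carrier S \<and> y \<in> carrier S \<and> left_ids S E x = left_ids S E y}"

definition L_rel :: "('a, 'b) monoid_scheme \<Rightarrow> 'a set \<Rightarrow> ('a \<times> 'a) set" where
  "L_rel S E = {(x, y). x \<in> carrier S \<and> y \<in> carrier S \<and> right_ids S E x = right_ids S E y}"

text \<open>
  Only compatibility is required here: \<open>R_rel\<close> and \<open>L_rel\<close> are equivalences on the carrier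
  by construction.
\<close>

definition left_congruence :: "('a, 'b) monoid_scheme \<Rightarrow> ('a \<times> 'a) set \<Rightarrow> bool" where
  "left_congruence S r \<longleftrightarrow>
     (\<forall>a\<in>carrier S. \<forall>x y. (x, y) \<in> r \<longrightarrow> (a \<otimes>\<^bsub>S\<^esub> x, a \<otimes>\<^bsub>S\<^esub> y) \<in> r)"

definition right_congruence :: "('a, 'b) monoid_scheme \<Rightarrow> ('a \<times> 'a) set \<Rightarrow> bool" where
  "right_congruence S r \<longleftrightarrow>
     (\<forall>a\<in>carrier S. \<forall>x y. (x, y) \<in> r \<longrightarrow> (x \<otimes>\<^bsub>S\<^esub> a, y \<otimes>\<^bsub>S\<^esub> a) \<in> r)"

definition left_Ehresmann :: "('a, 'b) monoid_scheme \<Rightarrow> 'a set \<Rightarrow> bool" where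
  "left_Ehresmann S E \<longleftrightarrow>
     (\<forall>C \<in> carrier S // R_rel S E. \<exists>!e. e \<in> C \<and> e \<in> E) \<and> left_congruence S (R_rel S E)"

definition right_Ehresmann :: "('a, 'b) monoid_scheme \<Rightarrow> 'a set \<Rightarrow> bool" where
  "right_Ehresmann S E \<longleftrightarrow>
     (\<forall>C \<in> carrier S // L_rel S E. \<exists>!e. e \<in> C \<and> e \<in> E) \<and> right_congruence S (L_rel S E)"

definition Ehresmann :: "('a, 'b) monoid_scheme \<Rightarrow> 'a set \<Rightarrow> bool" where
  "Ehresmann S E \<longleftrightarrow> left_Ehresmann S E \<and> right_Ehresmann S E"

end

theory Submission
  imports Defs
begin

text \<open>
  Write \<open>id\<^sub>A\<close> for \<open>id_part X A\<close>. Everything rests on one computation: \<open>id\<^sub>A \<alpha>\<close> arises from \<open>\<alpha>\<close> by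
  cutting every upper vertex outside \<open>A\<close> off from its block and leaving all other connections
  alone (\<open>same_block_id_mult\<close>). Hence \<open>id\<^sub>A id\<^sub>B\<close> is the idempotent of \<open>A \<inter> B\<close>, and \<open>id\<^sub>A\<close> is a left
  identity of \<open>\<alpha>\<close> if and only if the upper vertices outside \<open>A\<close> are singleton blocks of \<open>\<alpha>\<close>.

  The left identities of \<open>\<alpha>\<close> thus record only which upper vertices are isolated, whereas
  multiplication on the left can isolate a further vertex by removing its neighbours. Let \<open>\<beta>\<close> have
  the two blocks \<open>X\<close> and \<open>X'\<close>. As \<open>X\<close> has at least two elements, neither \<open>\<beta>\<close> nor the identity
  \<open>id\<^sub>X\<close> has a singleton upper block, so they have the same left identities. For \<open>p \<in> X\<close> and the
  idempotent \<open>e\<close> of \<open>{p}\<close>, however, all upper blocks of \<open>e \<beta>\<close> are singletons, because \<open>p\<close>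
  has lost its neighbours in \<open>X\<close>, while in \<open>e id\<^sub>X = e\<close> the vertex \<open>p\<close> is still joined to \<open>p'\<close>. So the
  idempotent of the empty set is a left identity of the first product and not of the second
  (\<open>not_left_congruence_R_rel\<close>). The statement about the other side follows by turning all
  partitions upside down (\<open>left_congruence_if_right_congruence\<close>).
\<close>

section \<open>Partitions as equivalence relations\<close>

lemma same_block_equiv:
  assumes "partition_on U \<alpha>"
  shows "equiv U (same_block \<alpha>)"
  using equiv_partition_on[OF assms] by (simp add: same_block_def)

lemma partition_eqI:
  assumes "partition_on U \<alpha>" "partition_on U \<beta>"
    and "\<And>u v. (u, v) \<in> same_block \<alpha> \<longleftrightarrow> (u, v) \<in> same_block \<beta>"
  shows "\<alpha> = \<beta>"
proof -
  have quotient: "U // same_block \<gamma> = \<gamma>" if "partition_on U \<gamma>" for \<gamma>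
    using partition_on_eq_quotient[OF that] by (simp only: same_block_def)
  have "same_block \<alpha> = same_block \<beta>"
    by (intro subset_antisym subrelI) (simp_all only: assms(3))
  then have "U // same_block \<alpha> = U // same_block \<beta>"
    by (rule arg_cong)
  then show ?thesis
    by (simp only: quotient[OF assms(1)] quotient[OF assms(2)])
qed

lemma same_block_quotient:
  assumes "equiv U r"
  shows "same_block (U // r) = r"
proof (intro subset_antisym subrelI)
  fix u v assume "(u, v) \<in> same_block (U // r)"
  then obtain B where "B \<in> U // r" "u \<in> B" "v \<in> B"
    unfolding same_block_def by blast
  then show "(u, v) \<in> r"
    by (intro in_quotient_imp_in_rel[OF assms]) simp_all
next
  fix u v assume uv: "(u, v) \<in> r"
  with assms have "u \<in> U"
    by (simp add: equiv_class_eq_iff)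
  then have "r `` {u} \<in> U // r" "u \<in> r `` {u}"
    by (rule quotientI, rule equiv_class_self[OF assms])
  with uv show "(u, v) \<in> same_block (U // r)"
    unfolding same_block_def by blast
qed

lemma sym_product_graph: "sym (product_graph \<alpha> \<beta>)"
  unfolding sym_def product_graph_def same_block_def map_prod_def by force

lemma inj_outer_vertex: "inj outer_vertex"
  by (auto simp: inj_def outer_vertex_def split: sum.splits)

lemma
  shows partition_on_mult: "partition_on (X <+> X) (partition_mult X \<alpha> \<beta>)"
    and same_block_mult: "(u, v) \<in> same_block (partition_mult X \<alpha> \<beta>) \<longleftrightarrow>
      u \<in> X <+> X \<and> v \<in> X <+> X \<and>
      (outer_vertex u, outer_vertex v) \<in> (product_graph \<alpha> \<beta>)\<^sup>*"
proof -
  let ?r = "{(u, v). u \<in> X <+> X \<and> v \<in> X <+> X \<and>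
                    (outer_vertex u, outer_vertex v) \<in> (product_graph \<alpha> \<beta>)\<^sup>*}"
  have "equiv (X <+> X) ?r"
  proof (rule equivI)
    show "sym ?r"
      using sym_rtrancl[OF sym_product_graph] by (auto simp: sym_def)
  qed (auto simp: refl_on_def trans_def)
  then show "partition_on (X <+> X) (partition_mult X \<alpha> \<beta>)"
    and "(u, v) \<in> same_block (partition_mult X \<alpha> \<beta>) \<longleftrightarrow>
      u \<in> X <+> X \<and> v \<in> X <+> X \<and>
      (outer_vertex u, outer_vertex v) \<in> (product_graph \<alpha> \<beta>)\<^sup>*"
    unfolding partition_mult_def
    by (simp_all add: partition_on_quotient same_block_quotient)
qed

lemma product_graph_iff:
  "(Upper x, Upper y) \<in> product_graph \<alpha> \<beta> \<longleftrightarrow> (Inl x, Inl y) \<in> same_block \<alpha>"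
  "(Upper x, Middle y) \<in> product_graph \<alpha> \<beta> \<longleftrightarrow> (Inl x, Inr y) \<in> same_block \<alpha>"
  "(Middle x, Upper y) \<in> product_graph \<alpha> \<beta> \<longleftrightarrow> (Inr x, Inl y) \<in> same_block \<alpha>"
  "(Middle x, Middle y) \<in> product_graph \<alpha> \<beta> \<longleftrightarrow>
     (Inr x, Inr y) \<in> same_block \<alpha> \<or> (Inl x, Inl y) \<in> same_block \<beta>"
  "(Middle x, Lower y) \<in> product_graph \<alpha> \<beta> \<longleftrightarrow> (Inl x, Inr y) \<in> same_block \<beta>"
  "(Lower x, Middle y) \<in> product_graph \<alpha> \<beta> \<longleftrightarrow> (Inr x, Inl y) \<in> same_block \<beta>"
  "(Lower x, Lower y) \<in> product_graph \<alpha> \<beta> \<longleftrightarrow> (Inr x, Inr y) \<in> same_block \<beta>"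
  "(Upper x, Lower y) \<notin> product_graph \<alpha> \<beta>"
  "(Lower x, Upper y) \<notin> product_graph \<alpha> \<beta>"
proof -
  have image: "(s, t) \<in> map_prod f f ` r \<longleftrightarrow> (\<exists>u v. (u, v) \<in> r \<and> s = f u \<and> t = f v)"
    for f :: "'a + 'a \<Rightarrow> 'a vertex" and r s t
    by auto
  show "(Upper x, Upper y) \<in> product_graph \<alpha> \<beta> \<longleftrightarrow> (Inl x, Inl y) \<in> same_block \<alpha>"
    "(Upper x, Middle y) \<in> product_graph \<alpha> \<beta> \<longleftrightarrow> (Inl x, Inr y) \<in> same_block \<alpha>"
    "(Middle x, Upper y) \<in> product_graph \<alpha> \<beta> \<longleftrightarrow> (Inr x, Inl y) \<in> same_block \<alpha>"
    "(Middle x, Middle y) \<in> product_graph \<alpha> \<beta> \<longleftrightarrow>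
       (Inr x, Inr y) \<in> same_block \<alpha> \<or> (Inl x, Inl y) \<in> same_block \<beta>"
    "(Middle x, Lower y) \<in> product_graph \<alpha> \<beta> \<longleftrightarrow> (Inl x, Inr y) \<in> same_block \<beta>"
    "(Lower x, Middle y) \<in> product_graph \<alpha> \<beta> \<longleftrightarrow> (Inr x, Inl y) \<in> same_block \<beta>"
    "(Lower x, Lower y) \<in> product_graph \<alpha> \<beta> \<longleftrightarrow> (Inr x, Inr y) \<in> same_block \<beta>"
    "(Upper x, Lower y) \<notin> product_graph \<alpha> \<beta>"
    "(Lower x, Upper y) \<notin> product_graph \<alpha> \<beta>"
    unfolding product_graph_def rename_lower_def rename_upper_def Un_iff image
    by (simp_all add: split_sum_ex)
qed

section \<open>The idempotents of the symmetric inverse monoid\<close>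

lemma id_part_eq_images:
  "id_part X A =
    (\<lambda>a. {Inl a, Inr a}) ` A \<union> (\<lambda>x. {Inl x}) ` (X - A) \<union> (\<lambda>x. {Inr x}) ` (X - A)"
  by (simp add: id_part_def setcompr_eq_image set_diff_eq)

lemma partition_on_id_part:
  assumes "A \<subseteq> X"
  shows "partition_on (X <+> X) (id_part X A)"
  using assms by (intro partition_onI) (auto simp: id_part_eq_images disjnt_def)

lemma same_block_id_part:
  "A \<subseteq> X \<Longrightarrow> (Inl x, Inl y) \<in> same_block (id_part X A) \<longleftrightarrow> x = y \<and> x \<in> X"
  "A \<subseteq> X \<Longrightarrow> (Inr x, Inr y) \<in> same_block (id_part X A) \<longleftrightarrow> x = y \<and> x \<in> X"
  "A \<subseteq> X \<Longrightarrow> (Inl x, Inr y) \<in> same_block (id_part X A) \<longleftrightarrow> x = y \<and> x \<in> A"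
  "A \<subseteq> X \<Longrightarrow> (Inr x, Inl y) \<in> same_block (id_part X A) \<longleftrightarrow> x = y \<and> x \<in> A"
  by (auto simp: same_block_def id_part_eq_images bex_Un)

lemma id_part_inj:
  assumes "A \<subseteq> X" "B \<subseteq> X" "id_part X A = id_part X B"
  shows "A = B"
  using same_block_id_part(3)[OF assms(1)] same_block_id_part(3)[OF assms(2)] assms(3) by auto

text \<open>
  Contracting each edge between \<open>x\<close> and \<open>x''\<close> maps the product graph of \<open>id\<^sub>A\<close> and \<open>\<alpha>\<close> into the graph of
  \<open>\<alpha>\<close>, so multiplication by \<open>id\<^sub>A\<close> creates no new connections. An upper vertex outside \<open>A\<close> has only
  its loop, and all other connections of \<open>\<alpha>\<close> survive.
\<close>

lemma same_block_id_mult: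
  assumes "A \<subseteq> X" and \<alpha>: "partition_on (X <+> X) \<alpha>"
  shows "(u, v) \<in> same_block (partition_mult X (id_part X A) \<alpha>) \<longleftrightarrow>
    u \<in> X <+> X \<and> v \<in> X <+> X \<and>
    (u = v \<or> u \<in> A <+> X \<and> v \<in> A <+> X \<and> (u, v) \<in> same_block \<alpha>)"
proof -
  let ?G = "product_graph (id_part X A) \<alpha>"
  note graph = product_graph_iff same_block_id_part[OF assms(1)]
  note eq = same_block_equiv[OF \<alpha>]
  (* The contraction of x and x'' *)
  define c where "c = case_vertex Inl Inl (Inr :: 'a \<Rightarrow> 'a + 'a)"
  have c_outer: "c (outer_vertex w) = w" for w
    by (cases w) (auto simp: c_def outer_vertex_def)
  have edge: "(c s, c t) \<in> same_block \<alpha>" if "(s, t) \<in> ?G" for s t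
    using that assms(1) equiv_type[OF eq] eq
    by (cases s; cases t) (auto simp: c_def graph equiv_def refl_on_def)
  have path: "(c s, c t) \<in> same_block \<alpha>" if "(s, t) \<in> ?G\<^sup>*" "c s \<in> X <+> X" for s t
    using that
  proof (induction rule: rtrancl_induct)
    case base
    with eq show ?case by (auto simp: equiv_def refl_on_def)
  next
    case (step t w)
    with eq edge show ?case by (meson equivE transE)
  qed
  have outer_Inl: "outer_vertex (Inl x) = Upper x" for x :: 'a
    by (simp add: outer_vertex_def)
  have isolated: "t = Upper x" if "(Upper x, t) \<in> ?G\<^sup>*" "x \<notin> A" for x t
    using that
  proof (induction rule: rtrancl_induct)
    case (step s t)
    then show ?case by (cases t) (auto simp: graph)
  qed simp
  have isolated': "t = Upper x" if "(t, Upper x) \<in> ?G\<^sup>*" "x \<notin> A" for x t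
    using that isolated sym_rtrancl[OF sym_product_graph] by (metis symD)
  show ?thesis
  proof (cases "u = v \<or> u \<notin> X <+> X \<or> v \<notin> X <+> X")
    case True
    then show ?thesis by (auto simp: same_block_mult)
  next
    case False
    then have UV: "u \<in> X <+> X" "v \<in> X <+> X" "u \<noteq> v" by auto
    show ?thesis
    proof (cases "u \<in> A <+> X \<and> v \<in> A <+> X")
      case True
      (* The copy of \<alpha> inside the product graph; w and m w are joined whenever w is in A <+> X. *)
      define m where "m = case_sum Middle (Lower :: 'a \<Rightarrow> 'a vertex)"
      have to_m: "(outer_vertex w, m w) \<in> ?G\<^sup>* \<and> (m w, outer_vertex w) \<in> ?G\<^sup>*"
        if "w \<in> A <+> X" for w
        using that by (cases w) (auto simp: m_def outer_vertex_def graph)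
      have "(m u, m v) \<in> ?G" if "(u, v) \<in> same_block \<alpha>"
        using that by (cases u; cases v) (auto simp: m_def graph)
      with to_m True have "(outer_vertex u, outer_vertex v) \<in> ?G\<^sup>*" if "(u, v) \<in> same_block \<alpha>"
        using that by (meson rtrancl.rtrancl_into_rtrancl rtrancl_trans)
      moreover have "(u, v) \<in> same_block \<alpha>" if "(outer_vertex u, outer_vertex v) \<in> ?G\<^sup>*"
        using path[OF that] UV by (simp add: c_outer)
      ultimately show ?thesis using True UV by (auto simp: same_block_mult)
    next
      case F: False
      have "(outer_vertex u, outer_vertex v) \<notin> ?G\<^sup>*"
      proof
        assume *: "(outer_vertex u, outer_vertex v) \<in> ?G\<^sup>*"
        from F UV consider x where "u = Inl x" "x \<notin> A" | x where "v = Inl x" "x \<notin> A"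
          by auto
        then have "outer_vertex u = outer_vertex v"
          using * isolated isolated' by cases (metis outer_Inl)+
        with UV show False using inj_outer_vertex by (auto dest: injD)
      qed
      with F UV show ?thesis by (auto simp: same_block_mult)
    qed
  qed
qed

lemma id_part_mult:
  assumes "A \<subseteq> X" "B \<subseteq> X"
  shows "partition_mult X (id_part X A) (id_part X B) = id_part X (A \<inter> B)"
proof (rule partition_eqI)
  show "partition_on (X <+> X) (id_part X (A \<inter> B))"
    using assms by (simp add: partition_on_id_part le_infI1)
  show "(u, v) \<in> same_block (partition_mult X (id_part X A) (id_part X B)) \<longleftrightarrow>
      (u, v) \<in> same_block (id_part X (A \<inter> B))" for u v
    using assms
    by (cases u; cases v)
      (auto simp: same_block_id_mult partition_on_id_part same_block_id_part le_infI1)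
qed (rule partition_on_mult)

lemma mult_sym_inv_monoid: "mult (sym_inv_monoid X) = partition_mult X"
  by (simp add: sym_inv_monoid_def partition_monoid_def)

lemma carrier_sym_inv_monoid:
  "carrier (sym_inv_monoid X) =
    {\<alpha>. partition_on (X <+> X) \<alpha> \<and> part_ker \<alpha> = Id_on X \<and> part_coker \<alpha> = Id_on X}"
  by (simp add: sym_inv_monoid_def partition_monoid_def)

text \<open>
  An element \<open>\<gamma>\<close> of the symmetric inverse monoid has no blocks but singletons and pairs \<open>{x, y'}\<close>.
  If \<open>{x, y'}\<close> is a block, then in the product graph of \<open>\<gamma>\<close> with itself \<open>x\<close> is joined only to \<open>y''\<close>
  and through it to at most one lower vertex \<open>z'\<close>, for a block \<open>{y, z'}\<close> of \<open>\<gamma>\<close>. If \<open>\<gamma>\<close> is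
  idempotent, then \<open>x\<close> is joined to \<open>y'\<close>, so \<open>z = y\<close>, so \<open>{x, y'}\<close> and \<open>{y, y'}\<close> are the
  same block and \<open>x = y\<close>.
\<close>

lemma idempotents_sym_inv_monoid:
  "idempotents (sym_inv_monoid X) = {id_part X A | A. A \<subseteq> X}"
proof (intro equalityI subsetI)
  fix \<gamma> assume "\<gamma> \<in> idempotents (sym_inv_monoid X)"
  then have \<gamma>: "partition_on (X <+> X) \<gamma>" and idem: "partition_mult X \<gamma> \<gamma> = \<gamma>"
    and k: "part_ker \<gamma> = Id_on X" and c: "part_coker \<gamma> = Id_on X"
    by (simp_all add: idempotents_def mult_sym_inv_monoid carrier_sym_inv_monoid)
  note eq = same_block_equiv[OF \<gamma>]
  have ker: "(Inl x, Inl y) \<in> same_block \<gamma> \<longleftrightarrow> x = y \<and> x \<in> X" for x y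
    using arg_cong[OF k, of "\<lambda>r. (x, y) \<in> r"] by (auto simp: part_ker_def Id_on_iff)
  have coker: "(Inr x, Inr y) \<in> same_block \<gamma> \<longleftrightarrow> x = y \<and> x \<in> X" for x y
    using arg_cong[OF c, of "\<lambda>r. (x, y) \<in> r"] by (auto simp: part_coker_def Id_on_iff)
  have symb: "(v, u) \<in> same_block \<gamma>" if "(u, v) \<in> same_block \<gamma>" for u v
    using eq that by (meson equivE symE)
  have cross: "(Inr y, Inl x) \<in> same_block \<gamma> \<longleftrightarrow> (Inl x, Inr y) \<in> same_block \<gamma>" for x y
    by (meson symb)
  have transb: "(u, w) \<in> same_block \<gamma>"
    if "(u, v) \<in> same_block \<gamma>" "(v, w) \<in> same_block \<gamma>" for u v w
    using eq that by (meson equivE transE)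
  have diag: "x = y" if xy: "(Inl x, Inr y) \<in> same_block \<gamma>" for x y
  proof -
    have reach: "t \<in> {Upper x, Middle y} \<union> Lower ` {z. (Inl y, Inr z) \<in> same_block \<gamma>}"
      if "(Upper x, t) \<in> (product_graph \<gamma> \<gamma>)\<^sup>*" for t
      using that
    proof (induction rule: rtrancl_induct)
      case (step s t)
      have middle: "y' = y" if "(Inl x, Inr y') \<in> same_block \<gamma>" for y'
        using transb[OF symb[OF xy] that] by (simp add: coker)
      have upper: "x' = x" if "(Inr y, Inl x') \<in> same_block \<gamma>" for x'
        using transb[OF xy that] by (simp add: ker)
      have lower: "y' = y"
        if "(Inl y, Inr z) \<in> same_block \<gamma>" "(Inr z, Inl y') \<in> same_block \<gamma>" for y' z
        using transb[OF that] by (simp add: ker)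
      from step.IH consider "s = Upper x" | "s = Middle y"
        | z where "s = Lower z" "(Inl y, Inr z) \<in> same_block \<gamma>"
        by blast
      then show ?case
      proof cases
        case 1
        with step.hyps(2) middle show ?thesis
          by (cases t) (simp_all add: product_graph_iff ker)
      next
        case 2
        with step.hyps(2) upper show ?thesis
          by (cases t) (auto simp add: product_graph_iff ker coker)
      next
        case 3
        with step.hyps(2) lower show ?thesis
          by (cases t) (auto simp add: product_graph_iff coker)
      qed
    qed simp
    have "(Inl x, Inr y) \<in> same_block (partition_mult X \<gamma> \<gamma>)"
      using xy idem by simp
    then have "(Upper x, Lower y) \<in> (product_graph \<gamma> \<gamma>)\<^sup>*"
      by (simp add: same_block_mult outer_vertex_def)
    with reach have "(Inl y, Inr y) \<in> same_block \<gamma>" by auto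
    from transb[OF xy symb[OF this]] show "x = y" by (simp add: ker)
  qed
  define A where "A = {x. (Inl x, Inr x) \<in> same_block \<gamma>}"
  then have A_iff: "x \<in> A \<longleftrightarrow> (Inl x, Inr x) \<in> same_block \<gamma>" for x
    by simp
  have AX: "A \<subseteq> X"
  proof
    fix x assume "x \<in> A"
    then have "(Inl x, Inr x) \<in> same_block \<gamma>" by (simp only: A_iff)
    from transb[OF this symb[OF this]] show "x \<in> X" by (simp add: ker)
  qed
  have "(u, v) \<in> same_block \<gamma> \<longleftrightarrow> (u, v) \<in> same_block (id_part X A)" for u v
    by (cases u; cases v) (auto simp: same_block_id_part[OF AX] ker coker A_iff cross
        dest: diag)
  then have "\<gamma> = id_part X A"
    by (rule partition_eqI[OF \<gamma> partition_on_id_part[OF AX]])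
  with AX show "\<gamma> \<in> {id_part X A | A. A \<subseteq> X}" by auto
next
  fix \<gamma> assume "\<gamma> \<in> {id_part X A | A. A \<subseteq> X}"
  then obtain A where A: "A \<subseteq> X" "\<gamma> = id_part X A" by auto
  have "part_ker \<gamma> = Id_on X" "part_coker \<gamma> = Id_on X"
    unfolding part_ker_def part_coker_def A(2) same_block_id_part[OF A(1)] by auto
  with A show "\<gamma> \<in> idempotents (sym_inv_monoid X)"
    by (simp add: idempotents_def mult_sym_inv_monoid carrier_sym_inv_monoid
        partition_on_id_part id_part_mult)
qed

section \<open>Failure of the left congruence property\<close>

lemma not_left_congruence_R_rel:
  fixes X :: "'a set"
  assumes pq: "p \<in> X" "q \<in> X" "p \<noteq> q"
  defines "E \<equiv> {id_part X A | A. A \<subseteq> X}"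
  shows "\<not> left_congruence (partition_monoid X) (R_rel (partition_monoid X) E)"
proof
  let ?S = "partition_monoid X"
  define \<beta> where "\<beta> = {Inl ` X, Inr ` X :: ('a + 'a) set}"
  have \<beta>: "partition_on (X <+> X) \<beta>"
    using pq by (intro partition_onI) (auto simp: \<beta>_def disjnt_def)
  have block: "(Inl x, Inl y) \<in> same_block \<beta> \<longleftrightarrow> x \<in> X \<and> y \<in> X"
    "(Inr x, Inr y) \<in> same_block \<beta> \<longleftrightarrow> x \<in> X \<and> y \<in> X"
    "(Inl x, Inr y) \<notin> same_block \<beta>" "(Inr x, Inl y) \<notin> same_block \<beta>" for x y
    by (auto simp: same_block_def \<beta>_def)

  have "left_ids ?S E (id_part X X) = {id_part X X}"
    by (auto simp: left_ids_def E_def partition_monoid_def id_part_mult Int_absorb2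
        dest: id_part_inj[rotated 2])
  moreover have "left_ids ?S E \<beta> = {id_part X X}"
  proof -
    have "partition_mult X (id_part X X) \<beta> = \<beta>"
    proof (rule partition_eqI[OF partition_on_mult \<beta>])
      show "(u, v) \<in> same_block (partition_mult X (id_part X X) \<beta>) \<longleftrightarrow> (u, v) \<in> same_block \<beta>"
        for u v
        by (cases u; cases v) (auto simp: same_block_id_mult \<beta> block)
    qed
    moreover have "A = X" if A: "A \<subseteq> X" "\<beta> = partition_mult X (id_part X A) \<beta>" for A
    proof -
      have "x \<in> A" if "x \<in> X" for x
      proof -
        from pq obtain y where y: "y \<in> X" "y \<noteq> x" by metis
        with that have "(Inl x, Inl y) \<in> same_block (partition_mult X (id_part X A) \<beta>)"
          using A(2) by (metis block(1))
        with y show ?thesis by (auto simp: same_block_id_mult[OF A(1) \<beta>])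
      qed
      with A(1) show ?thesis by auto
    qed
    ultimately show ?thesis
      by (auto simp: left_ids_def E_def partition_monoid_def)
  qed
  ultimately have related: "(id_part X X, \<beta>) \<in> R_rel ?S E"
    using \<beta> by (simp add: R_rel_def partition_monoid_def partition_on_id_part)

  let ?p = "id_part X {p}"
  have p: "?p \<in> carrier ?S"
    using pq by (simp add: partition_monoid_def partition_on_id_part)
  assume "left_congruence ?S (R_rel ?S E)"
  with related p have "(?p \<otimes>\<^bsub>?S\<^esub> id_part X X, ?p \<otimes>\<^bsub>?S\<^esub> \<beta>) \<in> R_rel ?S E"
    unfolding left_congruence_def by blast
  then have same: "left_ids ?S E ?p = left_ids ?S E (partition_mult X ?p \<beta>)"
    using pq by (simp add: R_rel_def partition_monoid_def id_part_mult)
  have "partition_mult X ?p \<beta> = partition_mult X (id_part X {}) (partition_mult X ?p \<beta>)"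
  proof (rule partition_eqI[OF partition_on_mult partition_on_mult])
    show "(u, v) \<in> same_block (partition_mult X ?p \<beta>) \<longleftrightarrow>
        (u, v) \<in> same_block (partition_mult X (id_part X {}) (partition_mult X ?p \<beta>))" for u v
      using pq
      by (cases u; cases v)
        (auto simp: same_block_id_mult \<beta> partition_on_mult block)
  qed
  then have "id_part X {} \<in> left_ids ?S E (partition_mult X ?p \<beta>)"
    by (auto simp: left_ids_def E_def partition_monoid_def)
  with same have "id_part X {} \<in> left_ids ?S E ?p" by simp
  then have "id_part X {p} = id_part X {}"
    using pq by (simp add: left_ids_def partition_monoid_def id_part_mult)
  with pq show False
    using id_part_inj[of "{p}" X "{}"] by simp
qed

section \<open>Duality\<close>

text \<open>
  Exchanging \<open>X\<close> and \<open>X'\<close> is an anti-automorphism of the partition monoid which fixes every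
  \<open>id\<^sub>A\<close>. It interchanges left and right identities, and hence the two congruence properties.
\<close>

definition swap :: "'a + 'a \<Rightarrow> 'a + 'a" where
  "swap = case_sum Inr Inl"

definition flip :: "('a + 'a) set set \<Rightarrow> ('a + 'a) set set" where
  "flip \<alpha> = (`) swap ` \<alpha>"

lemma swap_simps [simp]:
  "swap (Inl x) = Inr x" "swap (Inr x) = Inl x" "swap (swap u) = u"
  by (simp_all add: swap_def split: sum.splits)

lemma flip_flip [simp]: "flip (flip \<alpha>) = \<alpha>"
  by (simp add: flip_def image_image)

lemma same_block_flip:
  "(u, v) \<in> same_block (flip \<alpha>) \<longleftrightarrow> (swap u, swap v) \<in> same_block \<alpha>"
proof -
  have "u \<in> swap ` B \<longleftrightarrow> swap u \<in> B" for u :: "'a + 'a" and B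
    by (metis image_iff swap_simps(3))
  then show ?thesis by (simp add: same_block_def flip_def)
qed

lemma swap_in_Plus [simp]: "swap u \<in> X <+> X \<longleftrightarrow> u \<in> X <+> X"
  by (cases u) auto

lemma partition_on_flip:
  assumes "partition_on (X <+> X) \<alpha>"
  shows "partition_on (X <+> X) (flip \<alpha>)"
proof -
  have "inj_on swap (X <+> X)" by (metis inj_onI swap_simps(3))
  moreover have "swap ` (X <+> X) = X <+> X"
  proof
    show "X <+> X \<subseteq> swap ` (X <+> X)"
    proof
      fix u assume "u \<in> X <+> X"
      then show "u \<in> swap ` (X <+> X)" by (intro image_eqI[of _ _ "swap u"]) simp_all
    qed
  qed auto
  moreover have "{} \<notin> (`) swap ` \<alpha>"
    using partition_onD3[OF assms] by auto
  ultimately show ?thesis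
    using partition_on_inj_image[OF assms, of swap] by (simp add: flip_def)
qed

lemma flip_mult: "flip (partition_mult X \<alpha> \<beta>) = partition_mult X (flip \<beta>) (flip \<alpha>)"
proof (rule partition_eqI[OF partition_on_flip[OF partition_on_mult] partition_on_mult])
  define m :: "'a vertex \<Rightarrow> 'a vertex" where "m = case_vertex Lower Middle Upper"
  have path: "(m s, m t) \<in> (product_graph (flip \<beta>) (flip \<alpha>))\<^sup>*"
    if "(s, t) \<in> (product_graph \<alpha> \<beta>)\<^sup>*" for s t and \<alpha> \<beta> :: "('a + 'a) set set"
    using that
  proof (induction rule: rtrancl_induct)
    case (step t w)
    have "(m t, m w) \<in> product_graph (flip \<beta>) (flip \<alpha>)"
      using step.hyps(2)
      by (cases t; cases w) (auto simp: m_def product_graph_iff same_block_flip)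
    with step.IH show ?case by (rule rtrancl_into_rtrancl)
  qed simp
  have m: "m (outer_vertex u) = outer_vertex (swap u)" for u
    by (cases u) (simp_all add: m_def outer_vertex_def)
  show "(u, v) \<in> same_block (flip (partition_mult X \<alpha> \<beta>)) \<longleftrightarrow>
      (u, v) \<in> same_block (partition_mult X (flip \<beta>) (flip \<alpha>))" for u v
    using path[of "outer_vertex (swap u)" "outer_vertex (swap v)" \<alpha> \<beta>]
      path[of "outer_vertex u" "outer_vertex v" "flip \<beta>" "flip \<alpha>"]
    by (auto simp: same_block_flip same_block_mult m)
qed

lemma flip_id_part:
  assumes "A \<subseteq> X"
  shows "flip (id_part X A) = id_part X A"
proof (rule partition_eqI)
  show "(u, v) \<in> same_block (flip (id_part X A)) \<longleftrightarrow> (u, v) \<in> same_block (id_part X A)" for u v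
    using assms by (cases u; cases v) (auto simp: same_block_flip same_block_id_part)
qed (rule partition_on_flip[OF partition_on_id_part[OF assms]] partition_on_id_part[OF assms])+

lemma left_congruence_if_right_congruence:
  fixes X :: "'a set"
  defines "E \<equiv> {id_part X A | A. A \<subseteq> X}"
  assumes "right_congruence (partition_monoid X) (L_rel (partition_monoid X) E)"
  shows "left_congruence (partition_monoid X) (R_rel (partition_monoid X) E)"
proof -
  let ?S = "partition_monoid X"
  have mult: "flip (\<alpha> \<otimes>\<^bsub>?S\<^esub> \<beta>) = flip \<beta> \<otimes>\<^bsub>?S\<^esub> flip \<alpha>" for \<alpha> \<beta>
    by (simp add: partition_monoid_def flip_mult)
  have carrier: "flip \<alpha> \<in> carrier ?S \<longleftrightarrow> \<alpha> \<in> carrier ?S" for \<alpha>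
    using partition_on_flip[of X \<alpha>] partition_on_flip[of X "flip \<alpha>"]
    by (auto simp: partition_monoid_def)
  have "right_ids ?S E (flip \<alpha>) = left_ids ?S E \<alpha>" for \<alpha>
  proof -
    have "flip \<alpha> = flip \<alpha> \<otimes>\<^bsub>?S\<^esub> e \<longleftrightarrow> \<alpha> = e \<otimes>\<^bsub>?S\<^esub> \<alpha>" if "e \<in> E" for e
    proof -
      from that have "flip e = e" by (auto simp: E_def flip_id_part)
      then have "flip \<alpha> \<otimes>\<^bsub>?S\<^esub> e = flip (e \<otimes>\<^bsub>?S\<^esub> \<alpha>)" by (simp add: mult)
      then show ?thesis by (metis flip_flip)
    qed
    then show ?thesis by (auto simp: right_ids_def left_ids_def)
  qed
  then have "(flip \<alpha>, flip \<beta>) \<in> L_rel ?S E \<longleftrightarrow> (\<alpha>, \<beta>) \<in> R_rel ?S E" for \<alpha> \<beta>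
    by (simp add: L_rel_def R_rel_def carrier)
  with assms(2) show ?thesis
    unfolding left_congruence_def right_congruence_def by (metis mult carrier)
qed

section \<open>The partition monoid is not Ehresmann\<close>

theorem mainTheorem2:
  fixes X :: "'a set" and E :: "('a + 'a) set set set"
  assumes "infinite X \<or> card X \<ge> 2"
    and "E = idempotents (sym_inv_monoid X)"
  shows "E = {id_part X A | A. A \<subseteq> X} \<and>
    semilattice_in (partition_monoid X) E \<and>
    \<not> left_congruence (partition_monoid X) (R_rel (partition_monoid X) E) \<and>
    \<not> right_congruence (partition_monoid X) (L_rel (partition_monoid X) E) \<and>
    \<not> Ehresmann (partition_monoid X) E"
proof -
  have E: "E = {id_part X A | A. A \<subseteq> X}"
    using assms(2) by (simp add: idempotents_sym_inv_monoid)
  have "semilattice_in (partition_monoid X) E"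
    unfolding semilattice_in_def E
    by (auto simp: partition_monoid_def partition_on_id_part id_part_mult Int_commute
        intro!: exI[of _ "_ \<inter> _"])
  moreover obtain p q where "p \<in> X" "q \<in> X" "p \<noteq> q"
  proof -
    have "\<not> is_singleton X" "X \<noteq> {}"
      using assms(1) by (auto simp: is_singleton_def)
    then show ?thesis using that by (meson is_singletonI')
  qed
  then have "\<not> left_congruence (partition_monoid X) (R_rel (partition_monoid X) E)"
    unfolding E by (rule not_left_congruence_R_rel)
  moreover from this
  have "\<not> right_congruence (partition_monoid X) (L_rel (partition_monoid X) E)"
    using left_congruence_if_right_congruence unfolding E by blast
  ultimately show ?thesis
    using E by (simp add: Ehresmann_def left_Ehresmann_def)
qed

end
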